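(* For all integers $n\geq 2$ and $m\geq 1$ we have $\xi_{n,m}\leq 1/\eta_{n,m}$, where $$\eta_{n,m}:=1+\sum_{i=1}^{m-1}\binom{m-1}{i}\frac{1}{n^i-1}.$$ In particular, $\lim_{m\to\infty}\xi_{n,m}=0$ for every $n\geq 2$.
   Context: Let $X$ be a finite alphabet with $n\ge 2$ letters. A code with length distribution $L=(a_1,\ldots,a_m)$, where the $a_i$ are positive integers, is a finite sequence $(v_1,\ldots,v_m)$ of words $v_i\in X^*$ with $|v_i|=a_i$ for all $i$. A code is a prefix code if it is an injective sequence of non-empty words such that no $v_i$ is a prefix (initial segment) of another code word $v_j$, $j\ne i$. A code $(v_1,\ldots,v_m)$ is uniquely decodable if $v_{i_1}v_{i_2}\cdots v_{i_t}=v_{j_1}v_{j_2}\cdots v_{j_{t'}}$ with $t,t'\geq 1$ and all indices in $\{1,\ldots,m\}$ implies $t=t'$ and $i_s=j_s$ for every $1\leq s\leq t$. $UD_n(L)$ denotes the set of uniquely decodable codes over an $n$-letter alphabet with length distribution $L$, and $PR_n(L)\subseteq UD_n(L)$ the subset of prefix codes. $\mathcal{L}_{n,m}$ is the set of sequences $L$ of positive integers of length $|L|=m$ with $UD_n(L)\neq\emptyset$ (equivalently, by Kraft-McMillan, $PR_n(L)\ne\emptyset$, equivalently $\sum_{i=1}^m n^{-a_i}\leq 1$). Define $$\xi_{n,m}:=\inf_{L\in\mathcal{L}_{n,m}}\frac{|PR_n(L)|}{|UD_n(L)|}.$$ *)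

theory Defs
  imports Complex_Main "HOL-Library.Sublist"
begin

type_synonym 'a code = "'a list list"

definition codes :: "'a set \<Rightarrow> nat list \<Rightarrow> 'a code set" where
  "codes X L = {C. set C \<subseteq> lists X \<and> map length C = L}"

definition prefix_code :: "'a code \<Rightarrow> bool" where
  "prefix_code C \<longleftrightarrow>
     distinct C \<and> [] \<notin> set C \<and>
     (\<forall>i < length C. \<forall>j < length C. i \<noteq> j \<longrightarrow> \<not> prefix (C ! i) (C ! j))"

text \<open>The lists \<open>I\<close> and \<open>J\<close> are the index sequences of the two factorizations (0-based).\<close>

definition uniquely_decodable :: "'a code \<Rightarrow> bool" where
  "uniquely_decodable C \<longleftrightarrow>
     (\<forall>I J. I \<noteq> [] \<and> J \<noteq> [] \<and> set I \<subseteq> {..<length C} \<and> set J \<subseteq> {..<length C} \<and>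
        concat (map (\<lambda>i. C ! i) I) = concat (map (\<lambda>j. C ! j) J) \<longrightarrow> I = J)"

definition UD :: "'a set \<Rightarrow> nat list \<Rightarrow> 'a code set" where
  "UD X L = {C \<in> codes X L. uniquely_decodable C}"

definition PR :: "'a set \<Rightarrow> nat list \<Rightarrow> 'a code set" where
  "PR X L = {C \<in> UD X L. prefix_code C}"

definition length_dists :: "'a set \<Rightarrow> nat \<Rightarrow> nat list set" where
  "length_dists X m = {L. length L = m \<and> (\<forall>a \<in> set L. 0 < a) \<and> UD X L \<noteq> {}}"

text \<open>
  For \<open>finite X\<close>, \<open>card X \<ge> 2\<close> the set \<open>length_dists X m\<close> is nonempty, the sets \<open>UD X L\<close> are finite
  and nonempty for its members, and the ratios are bounded below by \<open>0\<close>, so the real infimum and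
  the division are proper. The value depends on \<open>X\<close> only through \<open>card X\<close>.
\<close>

definition xi :: "'a set \<Rightarrow> nat \<Rightarrow> real" where
  "xi X m = (INF L \<in> length_dists X m. real (card (PR X L)) / real (card (UD X L)))"

definition eta :: "nat \<Rightarrow> nat \<Rightarrow> real" where
  "eta n m = 1 + (\<Sum>i = 1..m - 1. real ((m - 1) choose i) * (1 / (real n ^ i - 1)))"

end

theory Submission
  imports Defs "HOL-Real_Asymp.Real_Asymp"
begin

text \<open>
  Let \<open>M = m - 1\<close> and take the length distribution \<open>(1, N, \<dots>, N)\<close> with \<open>M\<close> entries \<open>N\<close>. A code
  \<open>(x, v\<^sub>1, \<dots>, v\<^sub>M)\<close> of this type fails to be uniquely decodable only if some \<open>v\<^sub>i\<close> is the length-\<open>N\<close>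
  prefix of some \<open>x\<^sup>s v\<^sub>j\<close> with \<open>(i, s) \<noteq> (j, 0)\<close>. Each such coincidence determines \<open>v\<^sub>i\<close> from the other
  words, so a proportion of at most \<open>M\<^sup>2 (N + 1) / n\<^sup>N\<close> of all codes is not uniquely decodable. In a prefix
  code, on the other hand, no \<open>v\<^sub>i\<close> may begin with \<open>x\<close>, which leaves a proportion of \<open>(1 - 1/n)\<^sup>M\<close>.
  Letting \<open>N\<close> tend to infinity gives \<open>\<xi> \<le> (1 - 1/n)\<^sup>M\<close>, and \<open>\<eta> \<le> (1 + 1/(n - 1))\<^sup>M\<close> follows from the
  binomial theorem and \<open>(n - 1)\<^sup>i \<le> n\<^sup>i - 1\<close>.
\<close>

section \<open>Unique decodability in the absence of overlaps\<close>

text \<open>For words of length \<open>N\<close>, the shift \<open>s = 0\<close> makes the entries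
  pairwise distinct, and \<open>s = N\<close> forbids an entry that is a power of
  \<open>x\<close>.\<close>

definition overlap_free :: "'a \<Rightarrow> nat \<Rightarrow> 'a list list \<Rightarrow> bool" where
  "overlap_free x N vs \<longleftrightarrow>
     (\<forall>i < length vs. \<forall>j < length vs. \<forall>s \<le> N.
        vs ! i = replicate s x @ take (N - s) (vs ! j) \<longrightarrow> s = 0 \<and> i = j)"

lemma overlap_freeD:
  assumes "overlap_free x N vs" "i < length vs" "j < length vs" "s \<le> N"
    and "vs ! i = replicate s x @ take (N - s) (vs ! j)"
  shows "s = 0 \<and> i = j"
  using assms unfolding overlap_free_def by blast

text \<open>Having length \<open>N\<close>, the word \<open>vs ! j\<close> either is the power
  \<open>x^N\<close>, an overlap with itself at shift \<open>N\<close>, or ends inside the first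
  word \<open>vs ! k\<close> of \<open>w\<close>, an overlap at shift \<open>s\<close>.\<close>

lemma replicate_prefix_overlap:
  assumes free: "overlap_free x N vs" and len: "\<forall>v \<in> set vs. length v = N"
    and j: "j < length vs" and s: "s > 0" and w: "w = [] \<or> (\<exists>k < length vs. prefix (vs ! k) w)"
    and pre: "prefix (vs ! j) (replicate s x @ w)" and N: "N > 0"
  shows False
proof (cases "s \<ge> N \<or> w = []")
  case True
  have lj: "length (vs ! j) = N" using len j by simp
  have "vs ! j = take N (replicate s x @ w)"
    using pre lj by (metis append_eq_conv_conj prefix_def)
  \<comment> \<open>If \<open>w\<close> is empty, this length forces
    \<open>s \<ge> N\<close>.\<close>
  moreover have "length (take N (replicate s x @ w)) = N" using calculation lj by simp
  ultimately have "vs ! j = replicate N x" using True by (auto simp: min_def split: if_splits)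
  then have "vs ! j = replicate N x @ take (N - N) (vs ! j)" by simp
  from overlap_freeD[OF free j j _ this] N show False by simp
next
  case False
  then obtain k u where k: "k < length vs" and u: "w = vs ! k @ u"
    using w by (auto simp: prefix_def)
  have "vs ! j = take N (replicate s x @ vs ! k @ u)"
    using pre len j u by (metis append_eq_conv_conj prefix_def nth_mem)
  also have "\<dots> = replicate s x @ take (N - s) (vs ! k)"
    using False len k by simp
  finally show False
    using overlap_freeD[OF free j k, of s] s False by linarith
qed

text \<open>Index 0 will stand for the word \<open>[x]\<close>: a factorization is a power of
  \<open>x\<close> followed by a rest that is empty or starts with a long word.\<close>

lemma leading_zeros_decomposition:
  fixes I :: "nat list"
  shows "\<exists>s K. I = replicate s 0 @ K \<and> (K = [] \<or> hd K \<noteq> 0) \<and> (I \<noteq> [] \<and> hd I = 0 \<longrightarrow> s > 0)"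
proof (induction I)
  case Nil
  show ?case by (rule exI[of _ 0]) simp
next
  case (Cons a I)
  show ?case
  proof (cases "a = 0")
    case True
    from Cons obtain s K where "I = replicate s 0 @ K" "K = [] \<or> hd K \<noteq> 0" by blast
    then show ?thesis using True by (intro exI[of _ "Suc s"] exI[of _ K]) simp
  next
    case False
    then show ?thesis by (intro exI[of _ 0] exI[of _ "a # I"]) simp
  qed
qed

text \<open>Two factorizations of one word start with the same index, so the first factor cancels.
  Two long first factors agree because their lengths do, and shift 0 then identifies their
  indices.\<close>

lemma uniquely_decodable_letter_Cons:
  assumes free: "overlap_free x N vs" and len: "\<forall>v \<in> set vs. length v = N" and N: "N > 0"
  shows "uniquely_decodable ([x] # vs)"
proof -
  let ?C = "[x] # vs"
  let ?w = "\<lambda>I. concat (map (\<lambda>i. ?C ! i) I)"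
  let ?ok = "\<lambda>I. set I \<subseteq> {..<length ?C}"
  have nonempty: "?C ! i \<noteq> []" if "i < length ?C" for i
    using that len N by (cases i) (auto dest!: nth_mem)
  \<comment> \<open>The remaining case, letter against long word: collecting all leading letters
    \<open>x\<close> of the first factorization exposes a forbidden overlap.\<close>
  have letter: False if "?ok (0 # I)" "?ok (Suc j # J)" "?w (0 # I) = ?w (Suc j # J)" for I J j
  proof -
    obtain s K where s: "0 # I = replicate s 0 @ K" "K = [] \<or> hd K \<noteq> 0" "s > 0"
      using leading_zeros_decomposition[of "0 # I"] by auto
    have wI: "?w (0 # I) = replicate s x @ ?w K"
      unfolding s(1) by (induction s) auto
    have "?w K = [] \<or> (\<exists>k < length vs. prefix (vs ! k) (?w K))"
    proof (cases K)
      case (Cons k K')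
      have "k \<in> set (0 # I)" unfolding s(1) Cons by simp
      then have "k < length ?C" using that(1) by blast
      then show ?thesis using Cons s(2) by (cases k) auto
    qed simp
    moreover have "prefix (vs ! j) (replicate s x @ ?w K)"
      using that(3) unfolding wI by simp
    moreover have "j < length vs" using that(2) by simp
    ultimately show False
      using replicate_prefix_overlap[OF free len _ s(3) _ _ N] by blast
  qed
  have "?ok I \<Longrightarrow> ?ok J \<Longrightarrow> ?w I = ?w J \<Longrightarrow> I = J" for I J
  proof (induction I arbitrary: J)
    case Nil
    then show ?case using nonempty by (cases J) auto
  next
    case (Cons i I)
    show ?case
    proof (cases J)
      case Nil
      then show ?thesis using Cons.prems nonempty[of i] by simp
    next
      case (Cons j J')
      have "i = j"
      proof (cases i; cases j)
        fix i' j' assume ij: "i = Suc i'" "j = Suc j'"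
        then have l: "i' < length vs" "j' < length vs" using Cons.prems Cons by auto
        have "vs ! i' = vs ! j'" using Cons.prems(3) Cons ij l len by simp
        then show "i = j" using overlap_freeD[OF free l, of 0] ij l len by simp
      next
        fix j' assume "i = 0" "j = Suc j'"
        then show "i = j" using letter[of I j' J'] Cons.prems Cons by blast
      next
        fix i' assume "i = Suc i'" "j = 0"
        then show "i = j" using letter[of J' i' I] Cons.prems Cons by metis
      qed simp
      then show ?thesis using Cons.prems Cons Cons.IH[of J'] by simp
    qed
  qed
  then show ?thesis unfolding uniquely_decodable_def by blast
qed

section \<open>Counting uniquely decodable codes and prefix codes\<close>

text \<open>The alphabet may itself be a set of words: \<open>words (words X N) M\<close> consists
  of the \<open>M\<close>-tuples of words of length \<open>N\<close>, so one cardinality formula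
  serves both levels.\<close>

definition words :: "'a set \<Rightarrow> nat \<Rightarrow> 'a list set" where
  "words X N = {v. set v \<subseteq> X \<and> length v = N}"

lemma finite_words: "finite X \<Longrightarrow> finite (words X N)"
  unfolding words_def by (rule finite_lists_length_eq)

lemma card_words: "finite X \<Longrightarrow> card (words X N) = card X ^ N"
  unfolding words_def by (rule card_lists_length_eq)

lemma codes_letter_words:
  "codes X (1 # replicate M N) = (\<lambda>(x, vs). [x] # vs) ` (X \<times> words (words X N) M)"
proof (intro equalityI subsetI)
  fix C assume "C \<in> codes X (1 # replicate M N)"
  then obtain v vs where C: "C = v # vs" "length v = 1" "map length vs = replicate M N"
      "set C \<subseteq> lists X"
    unfolding codes_def by (auto simp: map_eq_Cons_conv)
  then obtain x where x: "v = [x]" by (cases v) auto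
  have "length vs = M" using C(3) by (metis length_map length_replicate)
  moreover have "\<forall>v \<in> set vs. length v = N"
    using C(3) by (metis imageI in_set_replicate list.set_map)
  ultimately show "C \<in> (\<lambda>(x, vs). [x] # vs) ` (X \<times> words (words X N) M)"
    using C x by (auto simp: words_def image_iff lists_eq_set)
next
  fix C assume "C \<in> (\<lambda>(x, vs). [x] # vs) ` (X \<times> words (words X N) M)"
  then show "C \<in> codes X (1 # replicate M N)"
    by (auto simp: codes_def words_def subset_iff intro!: replicate_eqI)
qed

text \<open>A violated condition determines one word from the other \<open>M - 1\<close>. There are
  at most \<open>M * M * Suc N\<close> ways to specify the violation, and
  \<open>card X ^ (N * (M - 1))\<close> choices for the other words.\<close>

lemma card_not_overlap_free:
  assumes X: "finite X"
  shows "card {vs \<in> words (words X N) M. \<not> overlap_free x N vs}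
           \<le> M * M * Suc N * card X ^ (N * (M - 1))"
proof -
  define U where "U = words (words X N) (M - 1)"
  \<comment> \<open>Undoes the deletion of entry \<open>i\<close>, using the word forced by the
    violation; \<open>k\<close> refers to the shortened list.\<close>
  define h where "h = (\<lambda>(i, k, s) us. take i us @ (replicate s x @ take (N - s) (us ! k)) # drop i us)"
  define P where "P = {..<M} \<times> {..<M} \<times> {..N}"
  have finU: "finite U" unfolding U_def by (intro finite_words X)
  have cardU: "card U = card X ^ (N * (M - 1))"
    unfolding U_def by (simp add: card_words finite_words X power_mult)
  have "{vs \<in> words (words X N) M. \<not> overlap_free x N vs} \<subseteq> (\<Union>p\<in>P. h p ` U)"
  proof
    fix vs assume "vs \<in> {vs \<in> words (words X N) M. \<not> overlap_free x N vs}"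
    then have vs: "set vs \<subseteq> words X N" "length vs = M" and "\<not> overlap_free x N vs"
      by (auto simp: words_def)
    then obtain i j s where ijs: "i < M" "j < M" "s \<le> N"
      and eq: "vs ! i = replicate s x @ take (N - s) (vs ! j)" and ne: "\<not> (s = 0 \<and> i = j)"
      unfolding overlap_free_def by auto
    define us where "us = take i vs @ drop (Suc i) vs"
    have "us \<in> U"
      using vs ijs set_take_subset[of i vs] set_drop_subset[of "Suc i" vs]
      by (auto simp: U_def us_def words_def[of "words X N"])
    have split: "vs = take i us @ vs ! i # drop i us"
      using ijs vs by (simp add: us_def id_take_nth_drop)
    have "\<exists>k < M. \<exists>t \<le> N. vs ! i = replicate t x @ take (N - t) (us ! k)"
    proof (cases "i = j")
      case False
      \<comment> \<open>Deleting entry \<open>i\<close> moves every later entry down by one.\<close>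
      have "vs ! j = us ! (if j < i then j else j - 1)"
        using False ijs vs by (auto simp: us_def nth_append min_def)
      then show ?thesis using eq ijs
        by (intro exI[of _ "if j < i then j else j - 1"]) auto
    next
      case True
      have len: "length (vs ! i) = N" using vs ijs by (auto simp: words_def dest!: nth_mem)
      \<comment> \<open>A word that overlaps itself after a shift by \<open>x\<^sup>s\<close>, \<open>s > 0\<close>, is a power of \<open>x\<close>.\<close>
      have "vs ! i ! p = x" if "p < N" for p
        using that
      proof (induction p rule: less_induct)
        case (less p)
        have "vs ! i ! p = (replicate s x @ take (N - s) (vs ! i)) ! p"
          using eq True by simp
        also have "\<dots> = x"
        proof (cases "p < s")
          case False
          then have "(replicate s x @ take (N - s) (vs ! i)) ! p = vs ! i ! (p - s)"
            using less.prems by (simp add: nth_append)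
          then show ?thesis using less.IH[of "p - s"] less.prems False ne True by simp
        qed (simp add: nth_append)
        finally show ?case .
      qed
      then have "vs ! i = replicate N x" using len by (intro nth_equalityI) auto
      \<comment> \<open>At shift \<open>N\<close> nothing is taken from \<open>us ! k\<close>, so
        \<open>k = i\<close> serves even when it lies beyond the end of \<open>us\<close>.\<close>
      then show ?thesis using ijs by (intro exI[of _ i]) auto
    qed
    then obtain k t where "k < M" "t \<le> N" "vs ! i = replicate t x @ take (N - t) (us ! k)"
      by blast
    then have "(i, k, t) \<in> P" "vs = h (i, k, t) us"
      using ijs split by (auto simp: P_def h_def)
    then show "vs \<in> (\<Union>p\<in>P. h p ` U)" using \<open>us \<in> U\<close> by blast
  qed
  then have "card {vs \<in> words (words X N) M. \<not> overlap_free x N vs} \<le> card (\<Union>p\<in>P. h p ` U)"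
    using finU by (intro card_mono) (auto simp: P_def)
  also have "\<dots> \<le> (\<Sum>p\<in>P. card (h p ` U))"
    by (intro card_UN_le) (simp add: P_def)
  also have "\<dots> \<le> (\<Sum>p\<in>P. card U)"
    by (intro sum_mono card_image_le finU)
  also have "\<dots> = M * M * Suc N * card X ^ (N * (M - 1))"
    by (simp add: P_def cardU algebra_simps)
  finally show ?thesis .
qed

lemma finite_UD: "finite X \<Longrightarrow> finite (UD X (1 # replicate M N))"
  unfolding UD_def codes_letter_words by (intro finite_Collect_conjI) (auto intro!: finite_words)

text \<open>For each letter, the tuples split into overlap-free ones, which give uniquely decodable
  codes, and the few others. The additive form avoids truncated subtraction.\<close>

lemma card_UD_lower_bound:
  assumes X: "finite X" and N: "N > 0"
  shows "card X * (card X ^ (N * M))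
           \<le> card (UD X (1 # replicate M N)) + card X * (M * M * Suc N * card X ^ (N * (M - 1)))"
proof -
  let ?c = "\<lambda>(x, vs). [x] # vs"
  define A where "A x = {vs \<in> words (words X N) M. overlap_free x N vs}" for x
  define B where "B x = {vs \<in> words (words X N) M. \<not> overlap_free x N vs}" for x
  have finW: "finite (words (words X N) M)" by (intro finite_words X)
  have fin: "finite (A x)" "finite (B x)" for x
    using finW by (auto simp: A_def B_def)
  have "card X ^ (N * M) = card (A x) + card (B x)" for x
  proof -
    have "card (A x \<union> B x) = card (A x) + card (B x)"
      by (intro card_Un_disjoint fin) (auto simp: A_def B_def)
    moreover have "A x \<union> B x = words (words X N) M" by (auto simp: A_def B_def)
    ultimately show ?thesis by (simp add: card_words finite_words X power_mult)
  qed
  then have "card X * card X ^ (N * M) = (\<Sum>x\<in>X. card (A x) + card (B x))"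
    by (simp flip: \<open>\<And>x. card X ^ (N * M) = card (A x) + card (B x)\<close>)
  also have "\<dots> = card (Sigma X A) + (\<Sum>x\<in>X. card (B x))"
    using X fin by (simp add: sum.distrib)
  also have "card (Sigma X A) = card (?c ` Sigma X A)"
    by (intro card_image[symmetric]) (auto simp: inj_on_def)
  also have "\<dots> \<le> card (UD X (1 # replicate M N))"
  proof (intro card_mono finite_UD X subsetI)
    fix C assume "C \<in> ?c ` Sigma X A"
    then obtain x vs where C: "C = [x] # vs" "x \<in> X" "vs \<in> A x" by auto
    then have "uniquely_decodable C"
      using uniquely_decodable_letter_Cons[OF _ _ N, of x vs] by (auto simp: A_def words_def)
    then show "C \<in> UD X (1 # replicate M N)"
      using C unfolding UD_def codes_letter_words A_def by auto
  qed
  also have "(\<Sum>x\<in>X. card (B x)) \<le> (\<Sum>x\<in>X. M * M * Suc N * card X ^ (N * (M - 1)))"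
    unfolding B_def by (intro sum_mono card_not_overlap_free X)
  also have "\<dots> = card X * (M * M * Suc N * card X ^ (N * (M - 1)))" by simp
  finally show ?thesis by simp
qed

text \<open>Each long word must avoid \<open>x\<close> as its first letter, which leaves
  \<open>card X - 1\<close> choices there and at most \<open>card X\<close> at each of the other
  \<open>N\<close> positions.\<close>

lemma card_PR_upper_bound:
  assumes X: "finite X"
  shows "card (PR X (1 # replicate M (Suc N))) \<le> card X * ((card X - 1) * card X ^ N) ^ M"
proof -
  let ?c = "\<lambda>(x, vs). [x] # vs"
  define V where "V x = (\<lambda>(y, v). y # v) ` ((X - {x}) \<times> words X N)" for x
  have finV: "finite (V x)" for x
    using X finite_words by (auto simp: V_def)
  have cardV: "card (V x) = (card X - 1) * card X ^ N" if "x \<in> X" for x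
  proof -
    have "card (V x) = card ((X - {x}) \<times> words X N)"
      unfolding V_def by (intro card_image) (auto simp: inj_on_def)
    then show ?thesis using that X by (simp add: card_words card_cartesian_product)
  qed
  have "PR X (1 # replicate M (Suc N)) \<subseteq> ?c ` (SIGMA x:X. words (V x) M)"
  proof
    fix C assume "C \<in> PR X (1 # replicate M (Suc N))"
    then have "C \<in> codes X (1 # replicate M (Suc N))" and pc: "prefix_code C"
      by (auto simp: PR_def UD_def)
    then obtain x vs where C: "C = [x] # vs" "x \<in> X" and vs: "vs \<in> words (words X (Suc N)) M"
      unfolding codes_letter_words by auto
    have "v \<in> V x" if v: "v \<in> set vs" for v
    proof -
      obtain j where j: "j < length vs" "v = vs ! j" using v by (metis in_set_conv_nth)
      have "v \<in> words X (Suc N)" using vs v by (auto simp: words_def)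
      then obtain y u where yu: "v = y # u" "y \<in> X" "u \<in> words X N"
        by (cases v) (auto simp: words_def)
      have "\<not> prefix (C ! 0) (C ! Suc j)"
        using pc j C(1) unfolding prefix_code_def by (metis Suc_less_eq length_Cons nat.simps(3) zero_less_Suc)
      then have "y \<noteq> x" using yu(1) unfolding j(2) C(1) by auto
      then show ?thesis using yu by (auto simp: V_def)
    qed
    then have "vs \<in> words (V x) M" using vs by (auto simp: words_def)
    then show "C \<in> ?c ` (SIGMA x:X. words (V x) M)" using C by force
  qed
  then have "card (PR X (1 # replicate M (Suc N))) \<le> card (?c ` (SIGMA x:X. words (V x) M))"
    using X finV by (intro card_mono finite_imageI finite_SigmaI finite_words) auto
  also have "\<dots> \<le> card (SIGMA x:X. words (V x) M)"
    using X finV by (intro card_image_le finite_SigmaI finite_words) auto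
  also have "\<dots> = (\<Sum>x\<in>X. card (words (V x) M))"
    using X finV by (intro card_SigmaI) (auto intro: finite_words)
  also have "\<dots> = card X * ((card X - 1) * card X ^ N) ^ M"
    using finV by (simp add: card_words cardV)
  finally show ?thesis .
qed

section \<open>From the counts to the infimum\<close>

lemma xi_le_ratio:
  assumes "L \<in> length_dists X m"
  shows "xi X m \<le> real (card (PR X L)) / real (card (UD X L))"
  unfolding xi_def by (intro cINF_lower assms bdd_belowI[of _ 0]) auto

text \<open>Both counts are compared with the number of all codes of this type, which cancels in the
  ratio. The assumption \<open>small\<close> keeps the lower bound for \<open>UD\<close> positive,
  so this length distribution is admissible.\<close>

lemma xi_le_ratio_bound:
  assumes X: "finite X" "card X \<ge> 2" and small: "real (M * M * Suc (Suc N)) / real (card X) ^ Suc N < 1"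
  shows "length_dists X (Suc M) \<noteq> {}"
    and "xi X (Suc M)
           \<le> (1 - 1 / real (card X)) ^ M / (1 - real (M * M * Suc (Suc N)) / real (card X) ^ Suc N)"
proof -
  define n where "n = real (card X)"
  define e where "e = real (M * M * Suc (Suc N)) / n ^ Suc N"
  define L where "L = 1 # replicate M (Suc N)"
  have n: "n \<ge> 2" using X by (simp add: n_def)
  have e: "e < 1" using small by (simp add: e_def n_def)
  have "real (M * M * Suc (Suc N)) * n ^ (Suc N * (M - 1)) = e * n ^ (Suc N * M)"
  \<comment> \<open>For \<open>M = 0\<close>, where \<open>M - 1\<close> is truncated, both sides
    vanish.\<close>
  proof (cases M)
    case (Suc k)
    have "n ^ (Suc N * M) = n ^ (Suc N * (M - 1)) * n ^ Suc N"
      unfolding Suc by (simp add: power_add[symmetric] algebra_simps)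
    then show ?thesis using n by (simp add: e_def)
  qed (simp add: e_def)
  moreover have "n * n ^ (Suc N * M)
      \<le> real (card (UD X L)) + n * (real (M * M * Suc (Suc N)) * n ^ (Suc N * (M - 1)))"
    using card_UD_lower_bound[OF X(1), of "Suc N" M, folded L_def, THEN of_nat_mono[where 'a=real]]
    by (simp add: n_def del: mult_Suc mult_Suc_right of_nat_Suc power_Suc)
  ultimately have UD: "n * n ^ (Suc N * M) * (1 - e) \<le> real (card (UD X L))"
    by (simp add: algebra_simps del: mult_Suc mult_Suc_right of_nat_Suc power_Suc)
  have pos: "0 < n * n ^ (Suc N * M) * (1 - e)" using n e by simp
  then have "UD X L \<noteq> {}" using UD by auto
  then have L: "L \<in> length_dists X (Suc M)" by (auto simp: length_dists_def L_def)
  then show "length_dists X (Suc M) \<noteq> {}" by blast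
  have "real (card (PR X L)) \<le> real (card X * ((card X - 1) * card X ^ N) ^ M)"
    using card_PR_upper_bound[OF X(1), of M N] unfolding L_def by (rule of_nat_mono)
  also have "\<dots> = n * ((n - 1) * n ^ N) ^ M"
    using X(2) by (simp add: n_def of_nat_diff)
  also have "(n - 1) * n ^ N = (1 - 1 / n) * n ^ Suc N"
    using n by (simp add: field_simps)
  also have "n * ((1 - 1 / n) * n ^ Suc N) ^ M = n * n ^ (Suc N * M) * (1 - 1 / n) ^ M"
    by (simp add: power_mult_distrib power_mult del: power_Suc mult_Suc)
  finally have PR: "real (card (PR X L)) \<le> n * n ^ (Suc N * M) * (1 - 1 / n) ^ M" .
  have "xi X (Suc M) \<le> real (card (PR X L)) / real (card (UD X L))"
    by (rule xi_le_ratio[OF L])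
  also have "\<dots> \<le> (n * n ^ (Suc N * M) * (1 - 1 / n) ^ M) / (n * n ^ (Suc N * M) * (1 - e))"
    using PR UD pos n by (intro frac_le) auto
  also have "\<dots> = (1 - 1 / n) ^ M / (1 - e)" using n by simp
  finally show "xi X (Suc M)
      \<le> (1 - 1 / real (card X)) ^ M / (1 - real (M * M * Suc (Suc N)) / real (card X) ^ Suc N)"
    by (simp only: e_def n_def)
qed

text \<open>The left-hand side of the previous bound does not depend on \<open>N\<close>, and the
  error \<open>e N\<close> tends to 0 for fixed \<open>M\<close>. Nonemptiness of
  \<open>length_dists\<close> is what makes 0 a lower bound of the infimum.\<close>

lemma xi_bounds:
  assumes X: "finite X" "card X \<ge> 2"
  shows "0 \<le> xi X (Suc M)" and "xi X (Suc M) \<le> (1 - 1 / real (card X)) ^ M"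
proof -
  define n where "n = real (card X)"
  define e where "e N = real (M * M * Suc (Suc N)) / n ^ Suc N" for N
  have n: "n > 1" using X by (simp add: n_def)
  have lim: "e \<longlonglongrightarrow> 0"
    unfolding e_def of_nat_mult of_nat_Suc using n by real_asymp
  then have ev: "\<forall>\<^sub>F N in sequentially. e N < 1"
    by (rule order_tendstoD) simp
  then obtain N where "e N < 1" by (meson eventually_happens' sequentially_bot)
  then have "length_dists X (Suc M) \<noteq> {}"
    using xi_le_ratio_bound(1)[OF X, of M N] unfolding e_def n_def by blast
  then show "0 \<le> xi X (Suc M)"
    unfolding xi_def by (intro cINF_greatest) auto
  have "(\<lambda>N. (1 - 1 / n) ^ M / (1 - e N)) \<longlonglongrightarrow> (1 - 1 / n) ^ M / (1 - 0)"
    by (intro tendsto_intros lim) simp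
  moreover have "\<forall>\<^sub>F N in sequentially. xi X (Suc M) \<le> (1 - 1 / n) ^ M / (1 - e N)"
    using ev
  proof eventually_elim
    case (elim N)
    then show ?case using xi_le_ratio_bound(2)[OF X, of M N] by (simp only: e_def n_def)
  qed
  ultimately have "xi X (Suc M) \<le> (1 - 1 / n) ^ M / (1 - 0)"
    by (intro tendsto_lowerbound) auto
  then show "xi X (Suc M) \<le> (1 - 1 / real (card X)) ^ M" by (simp add: n_def)
qed

section \<open>Estimating eta and conclusion\<close>

lemma power_pred_le:
  assumes "(a::real) \<ge> 1"
  shows "(a - 1) ^ Suc i \<le> a ^ Suc i - 1"
proof (induction i)
  case (Suc i)
  have "(a - 1) ^ Suc (Suc i) \<le> (a - 1) * (a ^ Suc i - 1)"
    using Suc assms by (simp add: mult_left_mono)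
  \<comment> \<open>The difference of the two sides is \<open>a + a ^ Suc i - 2\<close>.\<close>
  also have "\<dots> \<le> a ^ Suc (Suc i) - 1"
    using assms one_le_power[of a "Suc i"] by (simp add: algebra_simps)
  finally show ?case .
qed simp

lemma eta_bounds:
  assumes "n \<ge> 2"
  shows "0 < eta n (Suc M)" and "eta n (Suc M) \<le> (1 + 1 / (real n - 1)) ^ M"
proof -
  have pw: "(real n - 1) ^ i \<le> real n ^ i - 1" "0 < (real n - 1) ^ i" if "i \<ge> 1" for i
    using that power_pred_le[of "real n" "i - 1"] assms by auto
  have "0 \<le> (\<Sum>i = 1..M. real (M choose i) * (1 / (real n ^ i - 1)))"
    using assms by (intro sum_nonneg mult_nonneg_nonneg) (auto intro: one_le_power)
  then show "0 < eta n (Suc M)" by (simp add: eta_def)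
  have "eta n (Suc M) = 1 + (\<Sum>i = 1..M. real (M choose i) * (1 / (real n ^ i - 1)))"
    by (simp add: eta_def)
  also have "\<dots> \<le> 1 + (\<Sum>i = 1..M. real (M choose i) * (1 / (real n - 1) ^ i))"
    using pw by (intro add_left_mono sum_mono mult_left_mono divide_left_mono mult_pos_pos)
      (auto intro: less_le_trans[OF pw(2) pw(1), simplified])
  \<comment> \<open>The isolated 1 is the term \<open>i = 0\<close> of the binomial
    expansion.\<close>
  also have "\<dots> = (\<Sum>i\<le>M. real (M choose i) * (1 / (real n - 1) ^ i))"
    by (simp add: atMost_atLeast0 sum.atLeast_Suc_atMost)
  also have "\<dots> = (1 / (real n - 1) + 1) ^ M"
    unfolding binomial_ring by (simp add: power_one_over)
  finally show "eta n (Suc M) \<le> (1 + 1 / (real n - 1)) ^ M" by (simp add: add.commute)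
qed

theorem theorem3:
  fixes X :: "'a set" and n :: nat
  assumes "finite X" and "card X = n" and "n \<ge> 2"
  shows "(\<forall>m\<ge>1. xi X m \<le> 1 / eta n m) \<and> ((\<lambda>m. xi X m) \<longlonglongrightarrow> 0)"
proof (intro conjI allI impI)
  have X: "finite X" "card X \<ge> 2" using assms by auto
  note xi = xi_bounds[OF X, unfolded assms(2)]
  fix m :: nat assume "m \<ge> 1"
  then obtain M where m: "m = Suc M" by (cases m) auto
  have "xi X m \<le> (1 - 1 / real n) ^ M" using xi(2) m by simp
  also have "1 - 1 / real n = 1 / (1 + 1 / (real n - 1))"
    using assms(3) by (simp add: field_simps)
  also have "\<dots> ^ M = 1 / (1 + 1 / (real n - 1)) ^ M" by (simp add: power_one_over)
  also have "\<dots> \<le> 1 / eta n m"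
    using eta_bounds[OF assms(3), of M] m by (intro divide_left_mono mult_pos_pos) auto
  finally show "xi X m \<le> 1 / eta n m" .
next
  have X: "finite X" "card X \<ge> 2" using assms by auto
  note xi = xi_bounds[OF X, unfolded assms(2)]
  have "(\<lambda>M. (1 - 1 / real n) ^ M) \<longlonglongrightarrow> 0"
    using assms(3) by (intro LIMSEQ_power_zero) (simp add: abs_if)
  \<comment> \<open>Squeezed between 0 and a geometric sequence of ratio below 1; the index shift
    does not affect the limit.\<close>
  then have "(\<lambda>M. xi X (Suc M)) \<longlonglongrightarrow> 0"
    by (rule tendsto_sandwich[OF always_eventually always_eventually tendsto_const, rotated 2])
      (use xi in blast)+
  then show "(\<lambda>m. xi X m) \<longlonglongrightarrow> 0" by (simp add: filterlim_sequentially_Suc)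
qed

end
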